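(* Let $n \geq 1$. For all $\mathbf{x} = (x_1,\ldots,x_n) \in \mathbb{N}^n$, the number of $\mathbf{x}$-parking functions is \[ n! \sum_{T \in \mathrm{RPT}(n+1)} \left( \prod_{i=1}^{n} \frac{x_{i}^{\mathrm{outdeg}_T(i-1)}}{\mathrm{outdeg}_T(i-1)!} \right),\] where $\mathrm{outdeg}_T(i)$ denotes the number of children of the vertex $i$ in $T$.
   Context: $\mathbb{N} = \{0,1,2,\ldots\}$, and any zeroth power equals $1$. For $\mathbf{x} = (x_1,\ldots,x_n) \in \mathbb{N}^n$, an $\mathbf{x}$-parking function is a sequence $(\alpha_1,\ldots,\alpha_n) \in \mathbb{N}^n$ whose weakly increasing rearrangement $\alpha_{i_1} \leq \cdots \leq \alpha_{i_n}$ satisfies $\alpha_{i_j} \leq \left(\sum_{k=1}^{j} x_k\right) - 1$ for all $1 \leq j \leq n$. A rooted tree $T$ carries the partial order $\leq_T$ on its vertex set where $i \leq_T j$ iff the unique path in $T$ from $j$ to the root passes through $i$. A rooted plane tree on $n+1$ vertices is a rooted tree $T$ with vertex set $\{0,1,\ldots,n\}$ and root $0$ such that: (1) $i \leq_T j$ implies $i \leq j$ for all $1 \leq i,j \leq n$; (2) $i \leq_T k$ implies $i \leq_T j$ for all $1 \leq i<j<k \leq n$. The set of these is $\mathrm{RPT}(n+1)$. *)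

theory Defs
  imports Complex_Main
begin

text \<open>The vector $(x_1,\ldots,x_n)$ is the list \<open>x\<close> with $x_k$ at position $k - 1$.
  The bound is taken in \<open>int\<close> because it is $-1$ when $x_1 + \cdots + x_j = 0$.\<close>

definition parking_functions :: "nat list \<Rightarrow> nat list set" where
  "parking_functions x = {\<alpha>. length \<alpha> = length x \<and>
     (\<forall>j\<in>{1..length x}. int (sort \<alpha> ! (j - 1)) \<le> (\<Sum>k=1..j. int (x ! (k - 1))) - 1)}"

text \<open>Undirected graphs are given by their set of two-element edges; paths do not repeat vertices.\<close>

definition graph_path :: "'a set set \<Rightarrow> 'a \<Rightarrow> 'a list \<Rightarrow> 'a \<Rightarrow> bool" where
  "graph_path E u p v \<longleftrightarrow> p \<noteq> [] \<and> hd p = u \<and> last p = v \<and> distinct p \<and>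
     successively (\<lambda>a b. {a, b} \<in> E) p"

definition is_tree :: "'a set \<Rightarrow> 'a set set \<Rightarrow> bool" where
  "is_tree V E \<longleftrightarrow> V \<noteq> {} \<and> (\<forall>e\<in>E. e \<subseteq> V \<and> card e = 2) \<and>
     (\<forall>u\<in>V. \<forall>v\<in>V. \<exists>!p. graph_path E u p v)"

text \<open>All rooted trees below have root 0.\<close>

definition tree_le :: "nat set set \<Rightarrow> nat \<Rightarrow> nat \<Rightarrow> bool" where
  "tree_le T i j \<longleftrightarrow> i \<in> set (THE p. graph_path T j p 0)"

text \<open>The vertex set of a tree in \<open>RPT m\<close> is $\{0,\ldots,m-1\}$, so a tree is identified with its
  edge set.\<close>

definition RPT :: "nat \<Rightarrow> nat set set set" where
  "RPT m = {T. is_tree {..<m} T \<and>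
     (\<forall>i\<in>{1..<m}. \<forall>j\<in>{1..<m}. tree_le T i j \<longrightarrow> i \<le> j) \<and>
     (\<forall>i j k. 1 \<le> i \<and> i < j \<and> j < k \<and> k < m \<longrightarrow> tree_le T i k \<longrightarrow> tree_le T i j)}"

definition children :: "nat set set \<Rightarrow> nat \<Rightarrow> nat set" where
  "children T i = {j. {i, j} \<in> T \<and> tree_le T i j}"

definition outdeg :: "nat set set \<Rightarrow> nat \<Rightarrow> nat" where
  "outdeg T i = card (children T i)"

lemma finite_RPT: "finite (RPT m)"
proof (rule finite_subset)
  show "RPT m \<subseteq> Pow (Pow {..<m})"
    by (auto simp: RPT_def is_tree_def)
qed simp

end

theory Submission
  imports Defs "HOL-Combinatorics.Multiset_Permutations"
begin

text \<open>
  Both sides are sums over the same set of ballot sequences, that is, of $c = (c_0, \ldots, c_{n-1})$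
  with sum $n$ and $c_0 + \cdots + c_{j-1} \ge j$ for all $j \le n$.

  Cut $\{0, \ldots, x_1 + \cdots + x_n - 1\}$ into consecutive blocks of sizes $x_1, \ldots, x_n$, numbered
  from 0. A sequence is a parking function iff, for each $j$, at least $j$ of its entries lie in the
  first $j$ blocks, that is, iff the numbers $c_i$ of entries in block $i$ form a ballot sequence. Given $c$,
  there are $n!/\prod_i c_i!$ ways to distribute the positions over the blocks and then
  $\prod_i x_{i+1}^{c_i}$ ways to choose the entries inside them (\<open>card_parking_functions_ballot\<close>).

  On the other side, \<open>outdeg\<close> is a bijection from the plane trees to the ballot sequences. This is the
  classical coding of a plane tree by its degrees in depth-first order: the two conditions on the labels
  say that they follow such a traversal. In a traversal, each new vertex \<open>j\<close> is attached to the largest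
  earlier vertex that still lacks children, because a vertex that has been left is never visited
  again (\<open>preorder_numbered_saturated\<close>). So the degrees determine all parents one after the other, and
  \<open>outdeg\<close> is injective (\<open>inj_on_outdeg\<close>). Conversely, attaching vertices by this rule according to a
  given \<open>c\<close> never fails since \<open>c\<close> is a ballot sequence (\<open>ex_greedy_parent\<close>), and it yields a traversal
  (\<open>greedy_parent_preorder_numbered\<close>) with the degrees \<open>c\<close> (\<open>outdeg_image_RPT\<close>).

  Trees are handled through their parent functions: a function \<open>p\<close> with \<open>p j < j\<close> for $1 \le j \le n$
  always defines a tree (\<open>is_tree_parent_edges\<close>), and all the trees in question arise in this way
  (\<open>RPT_parent_function\<close>).
\<close>

section \<open>Counting parking functions by ballot sequences\<close>

text \<open>The main example is the degrees of a plane tree in depth-first order, without the last vertex, which is a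
  leaf. Positions from \<open>n\<close> on hold 0, the degree of that leaf and of numbers that are not vertices, so
  that the function \<open>outdeg T\<close> itself is such a sequence.\<close>

definition ballot_sequences :: "nat \<Rightarrow> (nat \<Rightarrow> nat) set" where
  "ballot_sequences n = {c. (\<forall>i\<ge>n. c i = 0) \<and> sum c {..<n} = n \<and> (\<forall>j\<le>n. j \<le> sum c {..<j})}"

text \<open>The parking functions for $x = (1, \ldots, 1)$: here \<open>j\<close> is the $j$-th partial sum.\<close>

definition parking_words :: "nat \<Rightarrow> nat list set" where
  "parking_words n = {w. length w = n \<and> (\<forall>j\<le>n. j \<le> length (filter (\<lambda>a. a < j) w))}"

definition partial_sum :: "nat list \<Rightarrow> nat \<Rightarrow> nat" where
  "partial_sum x j = sum ((!) x) {..<j}"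

text \<open>The values below \<open>partial_sum x (length x)\<close> split into consecutive blocks, the \<open>i\<close>-th of which has
  \<open>x ! i\<close> elements; \<open>block x a\<close> is the index of the block of \<open>a\<close>. It is unspecified when \<open>a\<close>
  is at least the sum of \<open>x\<close>, which is too large for an entry of a parking function.\<close>

definition block :: "nat list \<Rightarrow> nat \<Rightarrow> nat" where
  "block x a = (LEAST i. a < partial_sum x (Suc i))"

lemma sorted_nth_less_iff:
  fixes s :: "'a::linorder"
  shows "sorted ys \<Longrightarrow> i < length ys \<Longrightarrow> ys ! i < s \<longleftrightarrow> i < length (filter (\<lambda>a. a < s) ys)"
proof (induction ys arbitrary: i)
  case (Cons a ys)
  show ?case
  proof (cases "a < s")
    case True
    then show ?thesis using Cons by (cases i) auto
  next
    case False
    then have no: "\<not> b < s" if "b \<in> set (a # ys)" for b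
      using Cons.prems that by auto
    then have "filter (\<lambda>a. a < s) (a # ys) = []"
      by (meson filter_False)
    moreover have "\<not> (a # ys) ! i < s"
      using no Cons.prems(2) nth_mem by blast
    ultimately show ?thesis by (simp del: filter.simps)
  qed
qed simp

text \<open>The condition on the sorted rearrangement becomes a condition on the number of small entries, in
  which the order of the entries no longer matters: the $j$-th smallest entry is below a bound iff at
  least $j$ entries are.\<close>

lemma parking_functions_iff:
  "\<alpha> \<in> parking_functions x \<longleftrightarrow> length \<alpha> = length x \<and>
     (\<forall>j\<le>length x. j \<le> length (filter (\<lambda>a. a < partial_sum x j) \<alpha>))"
proof -
  have bound: "int (sort \<alpha> ! (j - 1)) \<le> (\<Sum>k=1..j. int (x ! (k - 1))) - 1 \<longleftrightarrow>
      j \<le> length (filter (\<lambda>a. a < partial_sum x j) \<alpha>)"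
    if "length \<alpha> = length x" "j \<in> {1..length x}" for j
  proof -
    have "(\<Sum>k=1..j. int (x ! (k - 1))) = (\<Sum>k<j. int (x ! k))"
      by (rule sum.reindex_bij_witness[of _ Suc "\<lambda>k. k - 1"]) auto
    then have "int (sort \<alpha> ! (j - 1)) \<le> (\<Sum>k=1..j. int (x ! (k - 1))) - 1 \<longleftrightarrow>
        sort \<alpha> ! (j - 1) < partial_sum x j"
      by (simp add: partial_sum_def flip: of_nat_sum)
    also have "\<dots> \<longleftrightarrow> j - 1 < length (filter (\<lambda>a. a < partial_sum x j) (sort \<alpha>))"
      using that by (intro sorted_nth_less_iff) auto
    also have "length (filter (\<lambda>a. a < partial_sum x j) (sort \<alpha>)) =
        length (filter (\<lambda>a. a < partial_sum x j) \<alpha>)"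
      by (metis mset_filter mset_sort size_mset)
    finally show ?thesis using that by auto
  qed
  show ?thesis
  proof (cases "length \<alpha> = length x")
    case True
    have "\<alpha> \<in> parking_functions x \<longleftrightarrow>
        (\<forall>j\<in>{1..length x}. j \<le> length (filter (\<lambda>a. a < partial_sum x j) \<alpha>))"
      by (simp only: parking_functions_def mem_Collect_eq bound[OF True] True simp_thms cong: ball_cong)
    also have "\<dots> \<longleftrightarrow> (\<forall>j\<le>length x. j \<le> length (filter (\<lambda>a. a < partial_sum x j) \<alpha>))"
      (is "(\<forall>j\<in>_. ?P j) = _")
    proof -
      have "?P j" if "\<forall>j\<in>{1..length x}. ?P j" "j \<le> length x" for j
        using that by (cases j) (simp_all only: atLeastAtMost_iff, auto)
      then show ?thesis by auto
    qed
    finally show ?thesis using True by simp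
  qed (simp add: parking_functions_def)
qed

lemma partial_sum_mono: "i \<le> j \<Longrightarrow> partial_sum x i \<le> partial_sum x j"
  unfolding partial_sum_def by (rule sum_mono2) auto

text \<open>The bounds in the definition of parking functions are block boundaries, so whether an entry respects
  them depends on its block only.\<close>

lemma block_less_iff:
  assumes "a < partial_sum x n"
  shows "block x a < j \<longleftrightarrow> a < partial_sum x j"
proof
  assume "block x a < j"
  have "n \<noteq> 0" using assms by (intro notI) (simp add: partial_sum_def)
  then have "a < partial_sum x (Suc (block x a))"
    using assms LeastI[of "\<lambda>i. a < partial_sum x (Suc i)" "n - 1"] by (simp add: block_def)
  also have "\<dots> \<le> partial_sum x j"
    using \<open>block x a < j\<close> by (intro partial_sum_mono) simp
  finally show "a < partial_sum x j" .
next
  assume "a < partial_sum x j"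
  moreover from this have "j \<noteq> 0" by (intro notI) (simp add: partial_sum_def)
  ultimately have "block x a \<le> j - 1"
    using Least_le[of "\<lambda>i. a < partial_sum x (Suc i)" "j - 1"] by (simp add: block_def)
  with \<open>j \<noteq> 0\<close> show "block x a < j" by simp
qed

lemma block_eq_iff:
  assumes "i < n"
  shows "a < partial_sum x n \<and> block x a = i \<longleftrightarrow> a \<in> {partial_sum x i..<partial_sum x (Suc i)}"
proof (cases "a < partial_sum x n")
  case True
  have "block x a = i \<longleftrightarrow> block x a < Suc i \<and> \<not> block x a < i" by linarith
  then show ?thesis using True unfolding block_less_iff[OF True] by (simp add: not_less conj_commute)
next
  case False
  moreover have "partial_sum x (Suc i) \<le> partial_sum x n"
    using assms by (intro partial_sum_mono) simp
  ultimately show ?thesis by simp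
qed

lemma parking_words_subset: "w \<in> parking_words n \<Longrightarrow> set w \<subseteq> {..<n}"
proof -
  assume w: "w \<in> parking_words n"
  then have "\<not> length (filter (\<lambda>a. a < n) w) < length w"
    unfolding parking_words_def by (simp add: not_less)
  then show ?thesis using length_filter_less[of _ w "\<lambda>a. a < n"] by blast
qed

lemma finite_parking_words: "finite (parking_words n)"
  by (rule finite_subset[OF _ finite_lists_length_eq[of "{..<n}" n]])
     (use parking_words_subset in \<open>auto simp: parking_words_def\<close>)

lemma parking_functions_iff_parking_words:
  "\<alpha> \<in> parking_functions x \<longleftrightarrow>
     (\<forall>a\<in>set \<alpha>. a < partial_sum x (length x)) \<and> map (block x) \<alpha> \<in> parking_words (length x)"
  (is "_ \<longleftrightarrow> ?small \<and> _")
proof -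
  have "?small" if "\<alpha> \<in> parking_functions x"
  proof -
    let ?f = "filter (\<lambda>a. a < partial_sum x (length x)) \<alpha>"
    have "length \<alpha> \<le> length ?f" using that by (auto simp: parking_functions_iff)
    then have "\<not> length ?f < length \<alpha>" by simp
    then show ?thesis using length_filter_less[of _ \<alpha> "\<lambda>a. a < partial_sum x (length x)"] by blast
  qed
  moreover have "\<alpha> \<in> parking_functions x \<longleftrightarrow> map (block x) \<alpha> \<in> parking_words (length x)" if ?small
  proof -
    have "length (filter (\<lambda>a. a < j) (map (block x) \<alpha>)) =
        length (filter (\<lambda>a. a < partial_sum x j) \<alpha>)" for j
    proof -
      have "filter (\<lambda>a. block x a < j) \<alpha> = filter (\<lambda>a. a < partial_sum x j) \<alpha>"
        using that by (intro filter_cong) (auto simp: block_less_iff)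
      then show ?thesis by (simp add: filter_map o_def)
    qed
    then show ?thesis by (simp add: parking_functions_iff parking_words_def)
  qed
  ultimately show ?thesis by blast
qed

lemma card_list_all2_mem:
  "card {ys. list_all2 (\<lambda>i y. y \<in> A i) w ys} = (\<Prod>i\<leftarrow>w. card (A i))"
proof (induction w)
  case Nil
  have "{ys. list_all2 (\<lambda>i y. y \<in> A i) [] ys} = {[]}" by auto
  then show ?case by simp
next
  case (Cons i w)
  let ?R = "{ys. list_all2 (\<lambda>i y. y \<in> A i) w ys}"
  have "{ys. list_all2 (\<lambda>i y. y \<in> A i) (i # w) ys} = (\<lambda>(y, ys). y # ys) ` (A i \<times> ?R)"
    by (auto simp: list_all2_Cons1 image_iff Bex_def)
  moreover have "inj_on (\<lambda>(y, ys). y # ys) (A i \<times> ?R)"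
    by (rule inj_onI) auto
  ultimately have "card {ys. list_all2 (\<lambda>i y. y \<in> A i) (i # w) ys} = card (A i \<times> ?R)"
    by (simp only: card_image)
  then show ?case using Cons by (simp add: card_cartesian_product)
qed

text \<open>Replacing every entry by its block maps parking functions to parking words, and by
  \<open>parking_functions_iff_parking_words\<close> every lift of a parking word is a parking function. The lifts
  of \<open>w\<close> choose each entry freely inside the prescribed block, so there are
  $\prod_i x_{w_i}$ of them.\<close>

lemma card_parking_functions:
  "card (parking_functions x) = (\<Sum>w\<in>parking_words (length x). \<Prod>i\<leftarrow>w. x ! i)"
proof -
  let ?n = "length x"
  let ?F = "\<lambda>w. {\<alpha>. list_all2 (\<lambda>i a. a \<in> {partial_sum x i..<partial_sum x (Suc i)}) w \<alpha>}"
  have fibre: "\<alpha> \<in> ?F w \<longleftrightarrow> (\<forall>a\<in>set \<alpha>. a < partial_sum x ?n) \<and> map (block x) \<alpha> = w"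
    if "w \<in> parking_words ?n" for w \<alpha>
  proof -
    have "set w \<subseteq> {..<?n}" using that by (rule parking_words_subset)
    then have "w ! l < ?n" if "l < length w" for l using that nth_mem by blast
    then have "\<alpha> \<in> ?F w \<longleftrightarrow> length w = length \<alpha> \<and>
        (\<forall>l<length w. \<alpha> ! l < partial_sum x ?n \<and> block x (\<alpha> ! l) = w ! l)"
      unfolding list_all2_conv_all_nth mem_Collect_eq using block_eq_iff[of _ ?n] by metis
    then show ?thesis
      by (auto simp: list_eq_iff_nth_eq all_set_conv_all_nth)
  qed
  then have union: "parking_functions x = (\<Union>w\<in>parking_words ?n. ?F w)"
    by (auto simp: parking_functions_iff_parking_words)
  have "finite {\<alpha>. list_all2 (\<lambda>i a. a \<in> {partial_sum x i..<partial_sum x (Suc i)}) w \<alpha>}" for w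
  proof (rule finite_subset)
    let ?m = "\<Sum>i\<leftarrow>w. partial_sum x (Suc i)"
    show "?F w \<subseteq> {\<alpha>. set \<alpha> \<subseteq> {..<?m} \<and> length \<alpha> = length w}"
    proof (intro subsetI CollectI conjI)
      fix \<alpha> a assume "\<alpha> \<in> ?F w" "a \<in> set \<alpha>"
      then obtain l where l: "l < length w" "a < partial_sum x (Suc (w ! l))"
        by (auto simp: list_all2_conv_all_nth in_set_conv_nth)
      have "partial_sum x (Suc (w ! l)) \<le> ?m"
        using l by (intro member_le_sum_list) auto
      with l show "a \<in> {..<?m}" by simp
    qed (auto simp: list_all2_lengthD)
  qed (simp add: finite_lists_length_eq)
  note finite = this
  have disjoint: "?F v \<inter> ?F w = {}"
    if "v \<in> parking_words ?n" "w \<in> parking_words ?n" "v \<noteq> w" for v w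
  proof -
    have False if "\<alpha> \<in> ?F v" "\<alpha> \<in> ?F w" for \<alpha>
      using that unfolding fibre[OF \<open>v \<in> _\<close>] fibre[OF \<open>w \<in> _\<close>] using \<open>v \<noteq> w\<close> by simp
    then show ?thesis by (meson disjoint_iff)
  qed
  have "card (parking_functions x) = (\<Sum>w\<in>parking_words ?n. card (?F w))"
    unfolding union
  proof (rule card_UN_disjoint)
    show "\<forall>w\<in>parking_words ?n. finite (?F w)" by (intro ballI finite)
    show "\<forall>v\<in>parking_words ?n. \<forall>w\<in>parking_words ?n. v \<noteq> w \<longrightarrow> ?F v \<inter> ?F w = {}"
      by (intro ballI impI disjoint)
  qed (rule finite_parking_words)
  also have "\<dots> = (\<Sum>w\<in>parking_words ?n. \<Prod>i\<leftarrow>w. x ! i)"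
    unfolding card_list_all2_mem by (simp add: partial_sum_def)
  finally show ?thesis .
qed

lemma length_filter_less_eq_sum:
  fixes w :: "nat list"
  shows "length (filter (\<lambda>a. a < j) w) = sum (count (mset w)) {..<j}"
proof (induction w)
  case (Cons a w)
  have "count (mset (a # w)) = (\<lambda>i. count (mset w) i + (if i = a then 1 else 0))" by auto
  then show ?case using Cons by (simp add: sum.distrib sum.delta)
qed simp

text \<open>The number of letters below \<open>j\<close> is a partial sum of the multiplicities, so the parking condition
  reads off the multiplicities alone.\<close>

lemma parking_words_iff_ballot:
  "w \<in> parking_words n \<longleftrightarrow> count (mset w) \<in> ballot_sequences n"
proof
  assume w: "w \<in> parking_words n"
  have set: "set w \<subseteq> {..<n}" using w by (rule parking_words_subset)
  then have "filter (\<lambda>a. a < n) w = w" by (auto intro: filter_True)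
  then have "sum (count (mset w)) {..<n} = length w"
    by (simp only: flip: length_filter_less_eq_sum)
  moreover have "count (mset w) i = 0" if "i \<ge> n" for i
    using set that by (auto simp: count_eq_zero_iff)
  ultimately show "count (mset w) \<in> ballot_sequences n"
    using w by (simp add: ballot_sequences_def parking_words_def length_filter_less_eq_sum)
next
  assume c: "count (mset w) \<in> ballot_sequences n"
  have "i < n" if "i \<in> set w" for i
  proof (rule ccontr)
    assume "\<not> i < n"
    then have "count (mset w) i = 0" using c by (simp add: ballot_sequences_def)
    with that show False using count_eq_zero_iff[of "mset w" i] by simp
  qed
  then have "filter (\<lambda>a. a < n) w = w" by (intro filter_True) blast
  then have "length w = sum (count (mset w)) {..<n}"
    by (simp only: flip: length_filter_less_eq_sum)
  then show "w \<in> parking_words n"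
    using c by (simp add: ballot_sequences_def parking_words_def length_filter_less_eq_sum)
qed

lemma count_parking_words: "(\<lambda>w. count (mset w)) ` parking_words n = ballot_sequences n"
proof (intro equalityI subsetI)
  fix c assume c: "c \<in> ballot_sequences n"
  have "{i. c i > 0} \<subseteq> {..<n}"
  proof (intro subsetI)
    fix i assume "i \<in> {i. c i > 0}"
    then show "i \<in> {..<n}"
      using c unfolding ballot_sequences_def by (cases "i < n") auto
  qed
  then have "finite {i. c i > 0}" by (rule finite_subset) simp
  then have "count (Abs_multiset c) = c" by (rule count_Abs_multiset)
  moreover obtain w where "mset w = Abs_multiset c" using ex_mset by blast
  ultimately have "c = count (mset w)" by simp
  with c show "c \<in> (\<lambda>w. count (mset w)) ` parking_words n"
    by (intro image_eqI[of _ _ w]) (simp_all only: parking_words_iff_ballot)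
qed (auto simp: parking_words_iff_ballot)

text \<open>The parking words with multiplicities \<open>c\<close> are all the rearrangements of one word; there are
  $n!/\prod_i c_i!$ of them, and all have the same number $\prod_i x_i^{c_i}$ of lifts.\<close>

lemma card_parking_functions_ballot:
  "real (card (parking_functions x)) = fact (length x) *
     (\<Sum>c\<in>ballot_sequences (length x). \<Prod>i<length x. real (x ! i) ^ c i / fact (c i))"
proof -
  let ?n = "length x"
  have "(\<Sum>w\<in>{w \<in> parking_words ?n. count (mset w) = c}. real (\<Prod>i\<leftarrow>w. x ! i)) =
      fact ?n * (\<Prod>i<?n. real (x ! i) ^ c i / fact (c i))"
    if c: "c \<in> ballot_sequences ?n" for c
  proof -
    obtain v where v: "v \<in> parking_words ?n" and cv: "c = count (mset v)"
      using c by (auto simp flip: count_parking_words)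
    have set: "set v \<subseteq> {..<?n}" using v by (rule parking_words_subset)
    have zero: "c i = 0" if "i \<notin> set v" for i
      using that by (simp add: cv count_eq_zero_iff)
    have words: "{w \<in> parking_words ?n. count (mset w) = c} = permutations_of_multiset (mset v)"
      using c by (auto simp: permutations_of_multiset_def parking_words_iff_ballot cv count_inject)
    have weight: "real (\<Prod>i\<leftarrow>w. x ! i) = (\<Prod>i<?n. real (x ! i) ^ c i)"
      if "w \<in> permutations_of_multiset (mset v)" for w
    proof -
      have "(\<Prod>i\<leftarrow>w. x ! i) = prod_mset (image_mset ((!) x) (mset v))"
        using that by (simp add: permutations_of_multiset_def flip: prod_mset_prod_list)
      also have "\<dots> = (\<Prod>i\<in>set v. (x ! i) ^ c i)"
        by (simp add: image_prod_mset_multiplicity cv)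
      also have "\<dots> = (\<Prod>i<?n. (x ! i) ^ c i)"
        using set by (intro prod.mono_neutral_left) (auto simp: zero)
      finally show ?thesis by simp
    qed
    have "card (permutations_of_multiset (mset v)) * (\<Prod>i\<in>set v. fact (c i)) = fact ?n"
      using card_permutations_of_multiset_aux[of "mset v"] v by (simp add: cv parking_words_def)
    also have "(\<Prod>i\<in>set v. fact (c i)) = (\<Prod>i<?n. fact (c i) :: nat)"
      using set by (intro prod.mono_neutral_left) (auto simp: zero)
    finally have "real (card (permutations_of_multiset (mset v)) * (\<Prod>i<?n. fact (c i))) =
        real (fact ?n)" by (rule arg_cong)
    then have card: "real (card (permutations_of_multiset (mset v))) = fact ?n / (\<Prod>i<?n. fact (c i))"
      by (simp add: field_simps)
    have "(\<Sum>w\<in>permutations_of_multiset (mset v). real (\<Prod>i\<leftarrow>w. x ! i)) =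
        real (card (permutations_of_multiset (mset v))) * (\<Prod>i<?n. real (x ! i) ^ c i)"
      using weight by simp
    then show ?thesis unfolding words card by (simp add: prod_dividef)
  qed
  note fibre = this
  have "real (card (parking_functions x)) = (\<Sum>w\<in>parking_words ?n. real (\<Prod>i\<leftarrow>w. x ! i))"
    by (simp add: card_parking_functions)
  also have "\<dots> = (\<Sum>c\<in>ballot_sequences ?n.
      \<Sum>w\<in>{w \<in> parking_words ?n. count (mset w) = c}. real (\<Prod>i\<leftarrow>w. x ! i))"
    unfolding count_parking_words[symmetric] by (rule sum.image_gen[OF finite_parking_words])
  also have "\<dots> = fact ?n * (\<Sum>c\<in>ballot_sequences ?n. \<Prod>i<?n. real (x ! i) ^ c i / fact (c i))"
    by (simp add: fibre sum_distrib_left)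
  finally show ?thesis .
qed

section \<open>Paths and leaves in trees\<close>

lemma graph_path_Cons:
  "graph_path E a (c # q) b \<longleftrightarrow> c = a \<and> (if q = [] then a = b
     else a \<notin> set q \<and> {a, hd q} \<in> E \<and> graph_path E (hd q) q b)"
  by (auto simp: graph_path_def successively_Cons)

lemma graph_path_rev: "graph_path E a (rev q) b \<longleftrightarrow> graph_path E b q a"
  by (auto simp: graph_path_def hd_rev last_rev insert_commute)

lemma graph_path_loop: "graph_path E a q a \<longleftrightarrow> q = [a]"
  by (cases q) (auto simp: graph_path_def split: if_splits)

lemma graph_path_mono: "graph_path E a q b \<Longrightarrow> E \<subseteq> F \<Longrightarrow> graph_path F a q b"
  unfolding graph_path_def using successively_mono[of "\<lambda>a b. {a, b} \<in> E" q "\<lambda>a b. {a, b} \<in> F"] by blast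

lemma graph_path_subset:
  assumes "\<forall>e\<in>E. e \<subseteq> V"
  shows "graph_path E a q b \<Longrightarrow> a \<in> V \<Longrightarrow> set q \<subseteq> V"
proof (induction q arbitrary: a)
  case (Cons c q)
  show ?case
  proof (cases "q = []")
    case False
    with Cons.prems have "{a, hd q} \<in> E" "graph_path E (hd q) q b" "c = a"
      by (simp_all add: graph_path_Cons)
    moreover from this have "hd q \<in> V" using assms by blast
    ultimately show ?thesis using Cons.IH[of "hd q"] Cons.prems(2) by simp
  qed (use Cons.prems in \<open>simp add: graph_path_Cons\<close>)
qed simp

text \<open>A new vertex of degree one cannot be an inner vertex of a path: both its neighbours on the path
  would have to be \<open>u\<close>.\<close>

lemma graph_path_avoid_leaf:
  assumes E: "\<forall>e\<in>E. e \<subseteq> V" and v: "v \<notin> V"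
    and path: "graph_path (insert {u, v} E) a q b" and "a \<noteq> v" "b \<noteq> v"
  shows "graph_path E a q b"
proof -
  have nbr: "w = u" if "{w, v} \<in> insert {u, v} E" for w
    using that E v by (auto simp: doubleton_eq_iff)
  have "v \<notin> set q"
  proof
    assume "v \<in> set q"
    then obtain xs ys where q: "q = xs @ v # ys" by (meson split_list)
    have xs: "xs \<noteq> []" and ys: "ys \<noteq> []"
      using path \<open>a \<noteq> v\<close> \<open>b \<noteq> v\<close> by (auto simp: q graph_path_def)
    have "successively (\<lambda>a b. {a, b} \<in> insert {u, v} E) (xs @ v # ys)"
      using path by (simp only: q graph_path_def)
    then have "{last xs, v} \<in> insert {u, v} E" "{v, hd ys} \<in> insert {u, v} E"
      using xs ys by (simp_all only: successively_append_iff successively_Cons list.sel simp_thms list.distinct)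
    then have "last xs = hd ys" using nbr insert_commute[of v "hd ys" "{}"] by metis
    then show False
      using path xs ys last_in_set[OF xs] hd_in_set[OF ys] by (auto simp: q graph_path_def)
  qed
  moreover have "{c, d} \<in> E" if "{c, d} \<in> insert {u, v} E" "c \<noteq> v" "d \<noteq> v" for c d
    using that by (auto simp: doubleton_eq_iff)
  ultimately have "successively (\<lambda>c d. {c, d} \<in> E) q"
    using path unfolding graph_path_def
    by (intro successively_mono[of "\<lambda>c d. {c, d} \<in> insert {u, v} E" q "\<lambda>c d. {c, d} \<in> E"]) metis+
  then show ?thesis using path by (simp add: graph_path_def)
qed

text \<open>A path from the new leaf must first step to its neighbour \<open>u\<close>, so it is an old path from \<open>u\<close> with
  the leaf put in front; paths to the leaf are the reversals of these.\<close>

lemma is_tree_add_leaf: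
  assumes tree: "is_tree V E" and u: "u \<in> V" and v: "v \<notin> V"
  shows "is_tree (insert v V) (insert {u, v} E)"
proof -
  let ?E = "insert {u, v} E"
  have E: "\<forall>e\<in>E. e \<subseteq> V" using tree by (simp add: is_tree_def)
  have unique: "\<exists>!q. graph_path E a q b" if "a \<in> V" "b \<in> V" for a b
    using tree that by (simp add: is_tree_def)
  have old: "graph_path ?E a q b \<longleftrightarrow> graph_path E a q b" if "a \<noteq> v" "b \<noteq> v" for a b q
    using graph_path_avoid_leaf[OF E v] graph_path_mono[of E a q b ?E] that by blast
  have new: "graph_path ?E v q b \<longleftrightarrow> (\<exists>r. q = v # r \<and> graph_path E u r b)" if "b \<in> V" for b q
  proof
    have "b \<noteq> v" using that v by blast
    assume path: "graph_path ?E v q b"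
    then obtain r where q: "q = v # r" by (cases q) (auto simp: graph_path_def)
    have "r \<noteq> []" "{v, hd r} \<in> ?E" "graph_path ?E (hd r) r b" "v \<notin> set r"
      using path \<open>b \<noteq> v\<close> by (simp_all add: q graph_path_Cons split: if_splits)
    moreover from this have "hd r = u" using E v by (auto simp: doubleton_eq_iff)
    moreover have "u \<noteq> v" using u v by blast
    ultimately show "\<exists>r. q = v # r \<and> graph_path E u r b"
      using q old[of u b r] \<open>b \<noteq> v\<close> by blast
  next
    assume "\<exists>r. q = v # r \<and> graph_path E u r b"
    then obtain r where r: "q = v # r" "graph_path E u r b" by blast
    have "v \<notin> set r" using graph_path_subset[OF E r(2) u] v by blast
    moreover have "r \<noteq> []" "hd r = u" using r(2) by (simp_all add: graph_path_def)
    ultimately show "graph_path ?E v q b"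
      using graph_path_mono[OF r(2), of ?E] by (simp add: r(1) graph_path_Cons insert_commute subset_insertI)
  qed
  have from_leaf: "\<exists>!q. graph_path ?E v q b" if b: "b \<in> V" for b
  proof -
    obtain r where "graph_path E u r b" "\<And>s. graph_path E u s b \<Longrightarrow> s = r"
      using unique[OF u b] by blast
    note r = this
    show ?thesis
    proof (rule ex1I)
      show "graph_path ?E v (v # r) b" unfolding new[OF b] using r(1) by blast
      show "q = v # r" if "graph_path ?E v q b" for q
        using that r(2) unfolding new[OF b] by blast
    qed
  qed
  have to_leaf: "\<exists>!q. graph_path ?E b q v" if b: "b \<in> V" for b
  proof -
    obtain r where "graph_path ?E v r b" "\<And>s. graph_path ?E v s b \<Longrightarrow> s = r"
      using from_leaf[OF b] by blast
    note r = this
    show ?thesis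
    proof (rule ex1I)
      show "graph_path ?E b (rev r) v" unfolding graph_path_rev by (rule r(1))
      show "q = rev r" if "graph_path ?E b q v" for q
        using that r(2)[of "rev q"] by (auto simp: graph_path_rev)
    qed
  qed
  have "\<exists>!q. graph_path ?E a q b" if "a \<in> insert v V" "b \<in> insert v V" for a b
  proof (cases "a = v"; cases "b = v")
    assume "a = v" "b = v" then show ?thesis by (simp add: graph_path_loop)
  next
    assume "a = v" "b \<noteq> v" then show ?thesis using from_leaf that by simp
  next
    assume "a \<noteq> v" "b = v" then show ?thesis using to_leaf that by simp
  next
    assume "a \<noteq> v" "b \<noteq> v" then show ?thesis using unique that old by simp
  qed
  moreover have "u \<noteq> v" using u v by blast
  moreover have "\<forall>e\<in>E. e \<subseteq> V \<and> card e = 2" using tree by (simp add: is_tree_def)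
  ultimately show ?thesis unfolding is_tree_def using u by auto
qed

section \<open>Trees as parent functions\<close>

text \<open>The parent functions of trees on $\{0,\ldots,n\}$ with root 0 whose labels increase away from the root.\<close>

definition decreasing :: "nat \<Rightarrow> (nat \<Rightarrow> nat) \<Rightarrow> bool" where
  "decreasing n p \<longleftrightarrow> (\<forall>j\<in>{1..n}. p j < j)"

definition parent_edges :: "nat \<Rightarrow> (nat \<Rightarrow> nat) \<Rightarrow> nat set set" where
  "parent_edges n p = (\<lambda>j. {p j, j}) ` {1..n}"

text \<open>The path that iterates \<open>p\<close> from \<open>j\<close>. Stopping where \<open>p\<close> fails to decrease makes the recursion total;
  for the functions in question this happens at 0 only.\<close>

fun root_path :: "(nat \<Rightarrow> nat) \<Rightarrow> nat \<Rightarrow> nat list" where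
  "root_path p j = (if 0 < j \<and> p j < j then j # root_path p (p j) else [j])"

declare root_path.simps [simp del]

lemma root_path_decreasing:
  "decreasing n p \<Longrightarrow> 0 < j \<Longrightarrow> j \<le> n \<Longrightarrow> root_path p j = j # root_path p (p j)"
  by (subst root_path.simps) (simp add: decreasing_def)

lemma root_path_0: "root_path p 0 = [0]"
  by (subst root_path.simps) simp

lemma self_in_root_path: "j \<in> set (root_path p j)"
  by (subst root_path.simps) simp

lemma set_root_path_le: "set (root_path p j) \<subseteq> {..j}"
proof (induction j rule: less_induct)
  case (less j)
  show ?case
  proof (cases "0 < j \<and> p j < j")
    case True
    then have "set (root_path p j) = insert j (set (root_path p (p j)))"
      by (subst root_path.simps) simp
    moreover have "set (root_path p (p j)) \<subseteq> {..p j}" using True less by blast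
    moreover have "{..p j} \<subseteq> {..j}" using True by auto
    ultimately show ?thesis by auto
  qed (subst root_path.simps, auto)
qed

lemma root_path_trans:
  "b \<in> set (root_path p j) \<Longrightarrow> set (root_path p b) \<subseteq> set (root_path p j)"
proof (induction j rule: less_induct)
  case (less j)
  show ?case
  proof (cases "b \<noteq> j \<and> 0 < j \<and> p j < j")
    case True
    then have eq: "set (root_path p j) = insert j (set (root_path p (p j)))"
      by (subst root_path.simps) simp
    then have "set (root_path p b) \<subseteq> set (root_path p (p j))"
      using True less by blast
    with eq show ?thesis by blast
  next
    case False
    then have "b = j" using less.prems by (subst (asm) root_path.simps) (auto split: if_splits)
    then show ?thesis by simp
  qed
qed

text \<open>The vertices are added as leaves in the order of their labels.\<close>

lemma is_tree_parent_edges: "decreasing n p \<Longrightarrow> is_tree {..<Suc n} (parent_edges n p)"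
proof (induction n)
  case 0
  have "{..<Suc 0} = {0 :: nat}" by auto
  moreover have "parent_edges 0 p = {}" by (simp add: parent_edges_def)
  ultimately show ?case by (simp add: is_tree_def graph_path_loop)
next
  case (Suc n)
  have "decreasing n p" "p (Suc n) < Suc n" using Suc.prems by (simp_all add: decreasing_def)
  then have "is_tree (insert (Suc n) {..<Suc n}) (insert {p (Suc n), Suc n} (parent_edges n p))"
    using Suc.IH by (intro is_tree_add_leaf) simp_all
  moreover have "{1..Suc n} = insert (Suc n) {1..n}" by auto
  ultimately show ?case by (simp only: parent_edges_def image_insert lessThan_Suc)
qed

lemma graph_path_root_path:
  assumes "decreasing n p"
  shows "j \<le> n \<Longrightarrow> graph_path (parent_edges n p) j (root_path p j) 0"
proof (induction j rule: less_induct)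
  case (less j)
  show ?case
  proof (cases "j = 0")
    case False
    then have pj: "p j < j" using assms less.prems by (simp add: decreasing_def)
    then have "graph_path (parent_edges n p) (p j) (root_path p (p j)) 0"
      using less by simp
    moreover from this have "hd (root_path p (p j)) = p j" "root_path p (p j) \<noteq> []"
      by (simp_all add: graph_path_def)
    moreover have "{j, p j} \<in> parent_edges n p"
      using False less.prems by (auto simp: parent_edges_def insert_commute)
    moreover have "j \<notin> set (root_path p (p j))"
      using set_root_path_le[of p "p j"] pj by auto
    ultimately show ?thesis
      using False less.prems by (simp add: root_path_decreasing[OF assms] graph_path_Cons)
  qed (simp add: root_path_0 graph_path_Cons)
qed

lemma tree_le_parent_edges:
  assumes "decreasing n p" and "j \<le> n"
  shows "tree_le (parent_edges n p) i j \<longleftrightarrow> i \<in> set (root_path p j)"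
proof -
  have "\<exists>!q. graph_path (parent_edges n p) j q 0"
    using is_tree_parent_edges[OF assms(1)] assms(2) by (simp add: is_tree_def)
  then have "(THE q. graph_path (parent_edges n p) j q 0) = root_path p j"
    using graph_path_root_path[OF assms] by (rule the1_equality)
  then show ?thesis by (simp add: tree_le_def)
qed

text \<open>An edge at \<open>i\<close> leads to one of its children or to its parent; the parent is not above \<open>i\<close> in
  the order on the tree, since labels increase along that order.\<close>

lemma children_parent_edges:
  assumes p: "decreasing n p"
  shows "children (parent_edges n p) i = {j \<in> {1..n}. p j = i}"
proof (intro equalityI subsetI)
  fix j assume "j \<in> children (parent_edges n p) i"
  then have edge: "{i, j} \<in> parent_edges n p" and le: "tree_le (parent_edges n p) i j"
    by (simp_all add: children_def)
  from edge obtain k where k: "k \<in> {1..n}" "{i, j} = {p k, k}" by (auto simp: parent_edges_def)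
  then have pk: "p k < k" using p by (simp add: decreasing_def)
  have "j = k"
  proof (rule ccontr)
    assume "j \<noteq> k"
    then have "i = k" "j = p k" using k(2) by (auto simp: doubleton_eq_iff)
    then have "i \<le> j"
      using le tree_le_parent_edges[OF p, of j i] set_root_path_le[of p j] k(1) pk by auto
    then show False using \<open>i = k\<close> \<open>j = p k\<close> pk by simp
  qed
  then show "j \<in> {j \<in> {1..n}. p j = i}" using k pk by (auto simp: doubleton_eq_iff)
next
  fix j assume "j \<in> {j \<in> {1..n}. p j = i}"
  then have j: "0 < j" "j \<le> n" "p j = i" by auto
  have "i \<in> set (root_path p j)"
    using j root_path_decreasing[OF p, of j] self_in_root_path[of i p] by simp
  then show "j \<in> children (parent_edges n p) i"
    using j tree_le_parent_edges[OF p, of j i] by (auto simp: children_def parent_edges_def)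
qed

text \<open>The second condition on rooted plane trees. For increasing labels it says that the labels of the
  vertices follow a depth-first traversal, as the labels below a vertex form an interval.\<close>

definition preorder_numbered :: "nat \<Rightarrow> (nat \<Rightarrow> nat) \<Rightarrow> bool" where
  "preorder_numbered n p \<longleftrightarrow> (\<forall>i j k. 1 \<le> i \<and> i < j \<and> j < k \<and> k \<le> n \<longrightarrow>
     i \<in> set (root_path p k) \<longrightarrow> i \<in> set (root_path p j))"

text \<open>The parent of \<open>j\<close> is the second vertex on the path from \<open>j\<close> to the root. Every edge \<open>{a, b}\<close> joins a
  vertex to its parent: either the path of \<open>b\<close> avoids \<open>a\<close> and prolongs to that of \<open>a\<close>, or it contains \<open>a\<close>
  and then it starts with \<open>b, a\<close>, since otherwise the edge would give a second, shorter path.\<close>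

lemma RPT_parent_function:
  assumes T: "T \<in> RPT (Suc n)"
  obtains p where "decreasing n p" "T = parent_edges n p"
proof -
  define P where "P j = (THE q. graph_path T j q 0)" for j
  define p where "p j = hd (tl (P j))" for j
  have tree: "is_tree {..<Suc n} T" using T by (simp add: RPT_def)
  have T_le: "\<forall>i\<in>{1..<Suc n}. \<forall>j\<in>{1..<Suc n}. tree_le T i j \<longrightarrow> i \<le> j"
    using T unfolding RPT_def by blast
  have unique: "\<exists>!q. graph_path T j q 0" if "j \<le> n" for j
    using tree that by (simp add: is_tree_def)
  have P: "graph_path T j (P j) 0" if "j \<le> n" for j
    unfolding P_def using unique[OF that] by (rule theI')
  have P_eq: "q = P j" if "graph_path T j q 0" "j \<le> n" for j q
    using unique[OF that(2)] P[OF that(2)] that(1) by blast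
  have P_step: "P j = j # P (p j) \<and> {j, p j} \<in> T \<and> p j < j" if "j \<in> {1..n}" for j
  proof -
    have j: "j \<le> n" "0 < j" using that by auto
    obtain q where q: "P j = j # q" using P[OF j(1)] by (cases "P j") (auto simp: graph_path_def)
    have path: "q \<noteq> []" "j \<notin> set q" "{j, hd q} \<in> T" "graph_path T (hd q) q 0"
      using P[OF j(1)] j(2) by (simp_all add: q graph_path_Cons split: if_splits)
    have hd: "hd q = p j" by (simp add: p_def q)
    have le: "p j \<le> n" using path(3) tree by (force simp: is_tree_def hd)
    have "tree_le T (p j) j"
      using hd_in_set[OF path(1)] q by (simp add: tree_le_def hd flip: P_def)
    moreover have "p j \<in> {1..<Suc n}" "j \<in> {1..<Suc n}" if "p j \<noteq> 0"
      using j le that by auto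
    ultimately have "p j \<le> j" if "p j \<noteq> 0" using T_le that by blast
    moreover have "p j \<noteq> j" using path(1,2) hd hd_in_set[OF path(1)] by auto
    ultimately have "p j < j" using j(2) by (cases "p j = 0") auto
    then show ?thesis using P_eq[of "p j" q] path(3,4) le by (simp add: hd q)
  qed
  have dec: "decreasing n p" using P_step by (simp add: decreasing_def)
  have P0: "P 0 = [0]" using P[of 0] by (simp add: graph_path_loop)
  have edge: "e \<in> parent_edges n p" if e: "e \<in> T" for e
  proof -
    have "card e = 2" "e \<subseteq> {..<Suc n}" using tree e by (auto simp: is_tree_def)
    then obtain a b where ab: "e = {a, b}" "a \<noteq> b" "a \<le> n" "b \<le> n" by (auto simp: card_2_iff)
    have Pb: "P b \<noteq> []" "hd (P b) = b" using P[OF ab(4)] by (auto simp: graph_path_def)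
    show ?thesis
    proof (cases "a \<in> set (P b)")
      case False
      then have "graph_path T a (a # P b) 0"
        using P[OF ab(4)] Pb e by (simp add: graph_path_Cons ab(1))
      then have "P a = a # P b" using P_eq ab(3) by metis
      moreover from this have "a \<noteq> 0" using P0 Pb(1) by (intro notI) simp
      ultimately have "a \<in> {1..n}" "p a = b" using ab Pb by (simp_all add: p_def)
      then show ?thesis using ab(1) by (auto simp: parent_edges_def)
    next
      case True
      have "b \<noteq> 0" using True ab(2) P0 by (intro notI) simp
      obtain q where q: "P b = b # q" using Pb by (cases "P b") auto
      with True ab(2) obtain xs ys where xs: "q = xs @ a # ys" by (auto dest: split_list)
      have "graph_path T b (b # a # ys) 0"
        using P[OF ab(4)] e ab(1)
        by (auto simp: q xs graph_path_def successively_append_iff successively_Cons insert_commute[of b a])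
      then have "P b = b # a # ys" using P_eq ab(4) by metis
      then have "p b = a" by (simp add: p_def)
      then show ?thesis using ab \<open>b \<noteq> 0\<close> by (auto simp: parent_edges_def)
    qed
  qed
  have "parent_edges n p \<subseteq> T" using P_step by (auto simp: parent_edges_def insert_commute)
  with edge have "T = parent_edges n p" by blast
  with dec that show ?thesis by blast
qed

lemma parent_edges_in_RPT_iff:
  assumes p: "decreasing n p"
  shows "parent_edges n p \<in> RPT (Suc n) \<longleftrightarrow> preorder_numbered n p"
proof -
  have "i \<le> j" if "i \<in> set (root_path p j)" for i j
    using that set_root_path_le[of p j] by blast
  then show ?thesis
    using is_tree_parent_edges[OF p]
    by (auto simp: RPT_def preorder_numbered_def tree_le_parent_edges[OF p] less_Suc_eq_le)
qed

section \<open>Depth-first labels and degree sequences\<close>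

text \<open>Depth-first traversal never returns to a vertex it has left. At the time \<open>j\<close> is attached to \<open>p j\<close>, the
  vertices strictly between \<open>p j\<close> and \<open>j\<close> are abandoned: a later child \<open>k\<close> of such an \<open>i\<close> would,
  by the interval condition, make \<open>i\<close> an ancestor of \<open>j\<close>, hence of \<open>p j\<close>, which is smaller than \<open>i\<close>.\<close>

lemma preorder_numbered_saturated:
  assumes p: "decreasing n p" "preorder_numbered n p" and j: "j \<in> {1..n}" and i: "p j < i" "i < j"
  shows "{k \<in> {1..n}. p k = i} = {k \<in> {1..<j}. p k = i}"
proof -
  have "k < j" if k: "k \<in> {1..n}" "p k = i" for k
  proof (rule ccontr)
    assume "\<not> k < j"
    moreover have "k \<noteq> j" using i k by auto
    ultimately have "j < k" by simp
    have "i \<in> set (root_path p k)"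
      using k root_path_decreasing[OF p(1), of k] self_in_root_path[of i p] by simp
    moreover have "1 \<le> i" "k \<le> n" using i k by auto
    ultimately have "i \<in> set (root_path p j)"
      using p(2) \<open>j < k\<close> i unfolding preorder_numbered_def by blast
    then have "i \<in> set (root_path p (p j))"
      using i j root_path_decreasing[OF p(1), of j] by simp
    then show False using i set_root_path_le[of p "p j"] by auto
  qed
  then show ?thesis using j by auto
qed

text \<open>So the parent of \<open>j\<close> is the largest earlier vertex that has not yet received all its children, and
  this can be read off the numbers of children and the parents of the vertices before \<open>j\<close>. At the
  first disagreement, the function with the smaller value would leave the other value
  saturated, although the other function still adds \<open>j\<close> there.\<close>

lemma parent_function_determined:
  assumes p: "decreasing n p" "preorder_numbered n p"
    and q: "decreasing n q" "preorder_numbered n q"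
    and deg: "\<And>i. card {k \<in> {1..n}. p k = i} = card {k \<in> {1..n}. q k = i}"
  shows "j \<in> {1..n} \<Longrightarrow> p j = q j"
proof (induction j rule: less_induct)
  case (less j)
  have False
    if r: "decreasing n r" "preorder_numbered n r" and s: "decreasing n s"
      and deg: "\<And>i. card {k \<in> {1..n}. r k = i} = card {k \<in> {1..n}. s k = i}"
      and eq: "\<And>k. k \<in> {1..<j} \<Longrightarrow> r k = s k"
      and lt: "r j < s j" for r s
  proof -
    have "s j < j" using s less.prems by (simp add: decreasing_def)
    have "card {k \<in> {1..n}. s k = s j} = card {k \<in> {1..n}. r k = s j}"
      by (rule deg[symmetric])
    also have "\<dots> = card {k \<in> {1..<j}. r k = s j}"
      by (simp only: preorder_numbered_saturated[OF r less.prems lt \<open>s j < j\<close>])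
    also have "{k \<in> {1..<j}. r k = s j} = {k \<in> {1..<j}. s k = s j}"
      using eq by auto
    also have "card \<dots> < card {k \<in> {1..n}. s k = s j}"
      using less.prems by (intro psubset_card_mono) auto
    finally show False by simp
  qed
  note no_less = this
  have eq: "p k = q k" if "k \<in> {1..<j}" for k using less that by simp
  have "\<not> p j < q j" using no_less[OF p q(1) deg eq] by blast
  moreover have "\<not> q j < p j" using no_less[OF q p(1) deg[symmetric] eq[symmetric]] by blast
  ultimately show ?case by simp
qed

lemma outdeg_parent_edges:
  "decreasing n p \<Longrightarrow> outdeg (parent_edges n p) i = card {j \<in> {1..n}. p j = i}"
  by (simp add: outdeg_def children_parent_edges)

lemma inj_on_outdeg: "inj_on outdeg (RPT (Suc n))"
proof (rule inj_onI)
  fix S T assume S: "S \<in> RPT (Suc n)" and T: "T \<in> RPT (Suc n)" and eq: "outdeg S = outdeg T"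
  obtain p where p: "decreasing n p" "S = parent_edges n p" using S by (rule RPT_parent_function)
  obtain q where q: "decreasing n q" "T = parent_edges n q" using T by (rule RPT_parent_function)
  have pre: "preorder_numbered n p" "preorder_numbered n q"
    using S T parent_edges_in_RPT_iff p q by simp_all
  have "card {k \<in> {1..n}. p k = i} = card {k \<in> {1..n}. q k = i}" for i
    using fun_cong[OF eq, of i] p q by (simp add: outdeg_parent_edges)
  then have "p j = q j" if "j \<in> {1..n}" for j
    using parent_function_determined[OF p(1) pre(1) q(1) pre(2) _ that] by blast
  then show "S = T" unfolding p(2) q(2) parent_edges_def by (intro image_cong) auto
qed

lemma sum_card_fibres:
  "finite A \<Longrightarrow> (\<Sum>i<m. card {k \<in> A. p k = i}) = card {k \<in> A. p k < (m::nat)}"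
proof -
  assume A: "finite A"
  have "card (\<Union>i\<in>{..<m}. {k \<in> A. p k = i}) = (\<Sum>i<m. card {k \<in> A. p k = i})"
    using A by (intro card_UN_disjoint) auto
  moreover have "(\<Union>i\<in>{..<m}. {k \<in> A. p k = i}) = {k \<in> A. p k < m}" by auto
  ultimately show ?thesis by simp
qed

text \<open>The vertices $1, \ldots, m$ are all children of vertices below \<open>m\<close>, so these have at least \<open>m\<close>
  children in total.\<close>

lemma decreasing_ballot:
  assumes p: "decreasing n p"
  shows "(\<lambda>i. card {j \<in> {1..n}. p j = i}) \<in> ballot_sequences n"
proof -
  have lt: "p j < j" if "j \<in> {1..n}" for j using p that by (simp add: decreasing_def)
  have "{j \<in> {1..n}. p j = i} = {}" if "i \<ge> n" for i
    using lt that by fastforce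
  moreover have "m \<le> (\<Sum>i<m. card {j \<in> {1..n}. p j = i})" if "m \<le> n" for m
  proof -
    have "{1..m} \<subseteq> {j \<in> {1..n}. p j < m}" using lt that by fastforce
    then have "card {1..m} \<le> card {j \<in> {1..n}. p j < m}" by (intro card_mono) simp_all
    then show ?thesis by (simp only: sum_card_fibres finite_atLeastAtMost card_atLeastAtMost)
  qed
  moreover have "(\<Sum>i<n. card {j \<in> {1..n}. p j = i}) = n"
  proof -
    have "{j \<in> {1..n}. p j < n} = {1..n}" using lt by fastforce
    then show ?thesis by (simp only: sum_card_fibres finite_atLeastAtMost card_atLeastAtMost)
  qed
  ultimately show ?thesis by (simp add: ballot_sequences_def)
qed

text \<open>\<open>p j\<close> is the largest \<open>i < j\<close> that has, among the vertices before \<open>j\<close>, fewer than \<open>c i\<close> children.\<close>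

definition greedy_parent :: "(nat \<Rightarrow> nat) \<Rightarrow> (nat \<Rightarrow> nat) \<Rightarrow> nat \<Rightarrow> bool" where
  "greedy_parent c p j \<longleftrightarrow> p j < j \<and> card {k \<in> {1..<j}. p k = p j} < c (p j) \<and>
     (\<forall>i. p j < i \<and> i < j \<longrightarrow> c i \<le> card {k \<in> {1..<j}. p k = i})"

text \<open>The greedy choice never gets stuck: if all vertices up to \<open>m\<close> were saturated by the children
  $1, \ldots, m$, then $c_0 + \cdots + c_m \le m$, against the ballot condition.\<close>

lemma ex_greedy_parent:
  assumes c: "\<forall>j\<le>n. j \<le> sum c {..<j}"
  shows "m \<le> n \<Longrightarrow> \<exists>p. \<forall>j\<in>{1..m}. greedy_parent c p j"
proof (induction m)
  case (Suc m)
  then obtain p where p: "\<forall>j\<in>{1..m}. greedy_parent c p j" by auto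
  define U where "U = {i. i < Suc m \<and> card {k \<in> {1..<Suc m}. p k = i} < c i}"
  have "U \<noteq> {}"
  proof
    assume "U = {}"
    then have "c i \<le> card {k \<in> {1..<Suc m}. p k = i}" if "i < Suc m" for i
      using that unfolding U_def by (metis (mono_tags, lifting) empty_Collect_eq not_le)
    then have "sum c {..<Suc m} \<le> (\<Sum>i<Suc m. card {k \<in> {1..<Suc m}. p k = i})"
      by (intro sum_mono) simp
    also have "\<dots> \<le> card {1..<Suc m}"
      unfolding sum_card_fibres[OF finite_atLeastLessThan] by (intro card_mono) auto
    also have "\<dots> < Suc m" by simp
    also have "\<dots> \<le> sum c {..<Suc m}" using c Suc.prems by blast
    finally show False by simp
  qed
  moreover have fin: "finite U" by (simp add: U_def)
  ultimately have max: "Max U \<in> U" by (rule Max_in[rotated])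
  have above: "c i \<le> card {k \<in> {1..<Suc m}. p k = i}" if "Max U < i" "i < Suc m" for i
  proof -
    have "i \<notin> U" using Max_ge[OF fin, of i] that(1) by linarith
    then show ?thesis using that(2) unfolding U_def mem_Collect_eq by linarith
  qed
  have below: "Max U < Suc m" "card {k \<in> {1..<Suc m}. p k = Max U} < c (Max U)"
    using max unfolding U_def by blast+
  define q where "q = p(Suc m := Max U)"
  have fibre: "{k \<in> {1..<j}. q k = i} = {k \<in> {1..<j}. p k = i}" if "j \<le> Suc m" for i j
    using that by (auto simp: q_def)
  have "greedy_parent c q j" if "j \<in> {1..Suc m}" for j
  proof (cases "j = Suc m")
    case False
    then have "j \<in> {1..m}" "j \<le> Suc m" "q j = p j" using that by (auto simp: q_def)
    moreover from this have "greedy_parent c p j" using p by blast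
    ultimately show ?thesis unfolding greedy_parent_def fibre[OF \<open>j \<le> Suc m\<close>] by simp
  next
    case True
    have "q (Suc m) = Max U" by (simp add: q_def)
    then show ?thesis
      unfolding greedy_parent_def True fibre[OF order_refl] using below above by metis
  qed
  then show ?case by blast
qed simp

text \<open>The last child of \<open>i\<close> was attached when \<open>i\<close> still had fewer than \<open>c i\<close> children.\<close>

lemma greedy_parent_card_le:
  assumes "\<forall>j\<in>{1..n}. greedy_parent c p j"
  shows "card {k \<in> {1..n}. p k = i} \<le> c i"
proof (cases "{k \<in> {1..n}. p k = i} = {}")
  case False
  let ?S = "{k \<in> {1..n}. p k = i}"
  have fin: "finite ?S" by simp
  define k where "k = Max ?S"
  have k: "k \<in> ?S" unfolding k_def using fin False by (rule Max_in)
  have "?S \<subseteq> insert k {l \<in> {1..<k}. p l = i}"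
  proof
    fix l assume "l \<in> ?S"
    then have "l \<le> k" unfolding k_def using fin by simp
    then show "l \<in> insert k {l \<in> {1..<k}. p l = i}" using \<open>l \<in> ?S\<close> by auto
  qed
  then have "card ?S \<le> card (insert k {l \<in> {1..<k}. p l = i})" by (intro card_mono) simp_all
  also have "\<dots> = Suc (card {l \<in> {1..<k}. p l = i})" by simp
  also have "\<dots> \<le> c i"
  proof -
    have "greedy_parent c p k" "p k = i" using assms k by auto
    then show ?thesis unfolding greedy_parent_def by simp
  qed
  finally show ?thesis .
qed (simp only: card.empty)

text \<open>If \<open>k\<close> is a child of \<open>b\<close>, then \<open>b\<close> was unsaturated at all times \<open>j\<close> with \<open>b < j < k\<close>, so no such \<open>j\<close> was
  attached below \<open>b\<close>. Following parents from \<open>j\<close> therefore decreases without skipping \<open>b\<close>, which makes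
  \<open>b\<close> an ancestor of \<open>j\<close>. An arbitrary ancestor \<open>i\<close> of \<open>k\<close> with \<open>i < j\<close> is handled at the step of the path from
  \<open>k\<close> to \<open>i\<close> that crosses \<open>j\<close>.\<close>

lemma greedy_parent_preorder_numbered:
  assumes greedy: "\<forall>j\<in>{1..n}. greedy_parent c p j"
  shows "preorder_numbered n p"
proof -
  have dec: "decreasing n p" using greedy by (simp add: decreasing_def greedy_parent_def)
  have not_below: "p k \<le> p j" if k: "k \<in> {1..n}" and j: "p k < j" "j < k" for j k
  proof (rule ccontr)
    assume "\<not> p k \<le> p j"
    have "greedy_parent c p j" using greedy j k by simp
    then have "c (p k) \<le> card {l \<in> {1..<j}. p l = p k}"
      using \<open>\<not> p k \<le> p j\<close> j by (simp add: greedy_parent_def)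
    also have "\<dots> \<le> card {l \<in> {1..<k}. p l = p k}"
      using j by (intro card_mono) auto
    also have "\<dots> < c (p k)" using greedy k unfolding greedy_parent_def by blast
    finally show False by simp
  qed
  have parent: "p k \<le> j \<Longrightarrow> j < k \<Longrightarrow> p k \<in> set (root_path p j)" if k: "k \<in> {1..n}" for j k
  proof (induction j rule: less_induct)
    case (less j)
    show ?case
    proof (cases "p k = j")
      case True
      then show ?thesis using self_in_root_path by simp
    next
      case False
      then have j: "p k < j" "0 < j" "j \<le> n" using less.prems k by auto
      then have "p j < j" using dec by (simp add: decreasing_def)
      moreover have "p k \<le> p j" using not_below[OF k j(1) less.prems(2)] .
      ultimately have "p k \<in> set (root_path p (p j))" using less by simp
      then show ?thesis using root_path_decreasing[OF dec j(2,3)] by simp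
    qed
  qed
  have "i \<in> set (root_path p k) \<Longrightarrow> i < j \<Longrightarrow> j < k \<Longrightarrow> k \<le> n \<Longrightarrow> i \<in> set (root_path p j)" for i j k
  proof (induction k rule: less_induct)
    case (less k)
    have k: "k \<in> {1..n}" "0 < k" using less.prems by auto
    then have "p k < k" using dec by (simp add: decreasing_def)
    have i: "i \<in> set (root_path p (p k))"
      using less.prems k root_path_decreasing[OF dec, of k] by auto
    show ?case
    proof (cases "j < p k")
      case True
      then show ?thesis using less.IH[OF \<open>p k < k\<close> i] less.prems \<open>p k < k\<close> by simp
    next
      case False
      then have "p k \<in> set (root_path p j)" using parent[OF k(1)] less.prems by simp
      then show ?thesis using root_path_trans i by blast
    qed
  qed
  then show ?thesis unfolding preorder_numbered_def by blast
qed

text \<open>For a ballot sequence \<open>c\<close>, the greedy tree has at most \<open>c i\<close> children at each \<open>i\<close>; both sides add up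
  to \<open>n\<close>, so these are equalities.\<close>

lemma outdeg_image_RPT: "outdeg ` RPT (Suc n) = ballot_sequences n"
proof (intro equalityI subsetI)
  fix c assume "c \<in> outdeg ` RPT (Suc n)"
  then obtain T where T: "T \<in> RPT (Suc n)" "c = outdeg T" by blast
  from T(1) obtain p where p: "decreasing n p" "T = parent_edges n p" by (rule RPT_parent_function)
  have "c = (\<lambda>i. card {j \<in> {1..n}. p j = i})"
    unfolding T(2) p(2) using outdeg_parent_edges[OF p(1)] by blast
  then show "c \<in> ballot_sequences n" using decreasing_ballot[OF p(1)] by simp
next
  fix c assume c: "c \<in> ballot_sequences n"
  then have "\<forall>j\<le>n. j \<le> sum c {..<j}" by (simp add: ballot_sequences_def)
  then obtain p where greedy: "\<forall>j\<in>{1..n}. greedy_parent c p j"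
    using ex_greedy_parent by blast
  have p: "decreasing n p" using greedy by (simp add: decreasing_def greedy_parent_def)
  let ?d = "\<lambda>i. card {j \<in> {1..n}. p j = i}"
  have d: "?d \<in> ballot_sequences n" using p by (rule decreasing_ballot)
  have le: "?d i \<le> c i" for i using greedy by (rule greedy_parent_card_le)
  have "?d i = c i" for i
  proof (cases "i < n")
    case True
    have "sum ?d {..<n} = sum c {..<n}" using c d by (simp add: ballot_sequences_def)
    then show ?thesis using sum_mono_inv[of ?d "{..<n}" c i] le True by simp
  next
    case False
    then show ?thesis using c d by (simp add: ballot_sequences_def)
  qed
  then have "c = outdeg (parent_edges n p)" using outdeg_parent_edges[OF p] by auto
  moreover have "parent_edges n p \<in> RPT (Suc n)"
    using greedy_parent_preorder_numbered[OF greedy] parent_edges_in_RPT_iff[OF p] by blast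
  ultimately show "c \<in> outdeg ` RPT (Suc n)" by blast
qed

section \<open>Parking functions and plane trees\<close>

theorem corollary1p11:
  fixes n :: nat and x :: "nat list"
  assumes "n \<ge> 1" and "length x = n"
  shows "real (card (parking_functions x)) =
    fact n * (\<Sum>T\<in>RPT (n + 1). \<Prod>i=1..n.
      real (x ! (i - 1)) ^ outdeg T (i - 1) / fact (outdeg T (i - 1)))"
proof -
  have "(\<Sum>T\<in>RPT (n + 1). \<Prod>i=1..n. real (x ! (i - 1)) ^ outdeg T (i - 1) / fact (outdeg T (i - 1))) =
      (\<Sum>T\<in>RPT (Suc n). \<Prod>i<n. real (x ! i) ^ outdeg T i / fact (outdeg T i))"
    unfolding Suc_eq_plus1[symmetric]
    by (intro sum.cong refl prod.reindex_bij_witness[of _ Suc "\<lambda>i. i - 1"]) auto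
  also have "\<dots> = (\<Sum>c\<in>ballot_sequences n. \<Prod>i<n. real (x ! i) ^ c i / fact (c i))"
    unfolding outdeg_image_RPT[symmetric] by (simp add: sum.reindex[OF inj_on_outdeg])
  finally show ?thesis
    using card_parking_functions_ballot[of x] unfolding assms(2) by (simp only:)
qed

end
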